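(* There exists a universal constant $C>0$ such that the following holds. Let $0<\alpha\le\beta$ be known, let $\kappa:=\beta/\alpha$, and let the target distribution $p$ belong to the class of univariate $\alpha$-strongly log-concave and $\beta$-log-smooth distributions with mode at $0$. Then the algorithm ENVELOPE uses at most $C\,(1+\log(1+\log\kappa))$ (that is, $O(\log\log\kappa)$) queries to the $0^{\rm th}$-order oracle to build the upper envelope $\tilde q$. Once $\tilde q$ is constructed, it can be used for either of the following tasks. 1. (Exact sampling) The algorithm SAMPLE returns an exact sample from $p$ after an additional number of oracle queries whose expectation is at most $C$. 2. (Approximate sampling) Let $0<\varepsilon<1$. If SAMPLE is limited to use at most $\lceil C\log(1/\varepsilon)\rceil$ oracle queries, then its output (or the symbol `FAILURE', if SAMPLE fails to accept a sample within the allowed number of queries) has a distribution, on $\mathbb R\cup\{\text{FAILURE}\}$, which is at total variation distance at most $\varepsilon$ from $p$.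
   Context: Class: for constants $0<\alpha\le\beta$, the class of univariate $\alpha$-strongly log-concave and $\beta$-log-smooth distributions is the class of continuous distributions $p$ on $\mathbb R$ whose density has the form $p(x)=\exp(-V(x))$ with $V$ twice continuously differentiable, $\alpha\le V''(x)\le\beta$ for all $x\in\mathbb R$, and mode at $0$, i.e. $V'(0)=0$. $0^{\rm th}$-order oracle: a query at $x\in\mathbb R$ returns $V(x)+c_0$, where $c_0$ is an unknown constant that does not change from query to query. Preprocessing (part of the algorithm): replace $V$ by $x\mapsto V(x/\sqrt\alpha)$, so that $1\le V''\le\kappa$ (a sample $\bar X$ for the rescaled target gives the sample $\bar X/\sqrt\alpha$ for the original one), and subtract the oracle's answer at $0$, so that $V(0)=0$. After this, write $V$ for the resulting potential and $\tilde p:=\exp(-V)$, the unnormalized target, which can be evaluated with one query per point. ENVELOPE: use binary search to find the first index $i_+\in\{0,1,\dots,\lceil\frac12\log_2\kappa\rceil\}$ with $V(2^{i_+}/\sqrt\kappa)\ge\frac12$, and the first index $i_-$ in the same set with $V(-2^{i_-}/\sqrt\kappa)\ge\frac12$. Put $x_-:=-2^{i_-}/\sqrt\kappa$ and $x_+:=2^{i_+}/\sqrt\kappa$, and return $$\tilde q(x):=\begin{cases}\exp\bigl[-\frac{x-x_-}{2x_-}-\frac{(x-x_-)^2}{2}\bigr], & x\le x_-,\\ 1, & x_-\le x\le x_+,\\ \exp\bigl[-\frac{x-x_+}{2x_+}-\frac{(x-x_+)^2}{2}\bigr], & x\ge x_+.\end{cases}$$ SAMPLE: let $q:=\tilde q/\int_{\mathbb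 R}\tilde q$. Repeatedly and independently draw $X\sim q$ and accept $X$ with probability $\tilde p(X)/\tilde q(X)$, until a sample is accepted; return the accepted $X$. Normalizing $\tilde q$ and drawing from $q$ cost no oracle queries; each accept/reject decision costs one query. (The term "upper envelope" means $\tilde q\ge\tilde p$ pointwise.) Total variation distance between probability measures $\mu,\nu$: $\sup_A|\mu(A)-\nu(A)|$ over measurable sets $A$; $p$ is regarded as a measure on $\mathbb R\cup\{\text{FAILURE}\}$ giving no mass to FAILURE. *)

theory Defs
  imports "HOL-Probability.Probability"
begin

section \<open>Adaptive algorithms with access to a real-valued oracle\<close>

text \<open>
  An algorithm either returns a value or asks for the oracle's value at a point and continues
  with the answer. The type is coinductive because rejection sampling need not terminate. It
  contains no oracle, so an algorithm learns about the target only through its queries.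
\<close>

codatatype 'a oracle_alg = Return 'a | Query real "real \<Rightarrow> 'a oracle_alg"

text \<open>Execution with a budget of at most \<open>n\<close> queries; \<open>None\<close> is the symbol FAILURE.\<close>

primrec run_within :: "nat \<Rightarrow> (real \<Rightarrow> real) \<Rightarrow> 'a oracle_alg \<Rightarrow> 'a option" where
  "run_within 0 f A = (case A of Return a \<Rightarrow> Some a | Query x k \<Rightarrow> None)"
| "run_within (Suc n) f A =
     (case A of Return a \<Rightarrow> Some a | Query x k \<Rightarrow> run_within n f (k (f x)))"

text \<open>The number of queries made until the algorithm returns; it is \<open>\<infinity>\<close> if it never does.\<close>

definition num_queries :: "(real \<Rightarrow> real) \<Rightarrow> 'a oracle_alg \<Rightarrow> enat" where
  "num_queries f A = (INF n\<in>{n. run_within n f A \<noteq> None}. enat n)"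

text \<open>Execution without a budget; here \<open>None\<close> means that the algorithm never returns.\<close>

definition run :: "(real \<Rightarrow> real) \<Rightarrow> 'a oracle_alg \<Rightarrow> 'a option" where
  "run f A = (if \<exists>n. run_within n f A \<noteq> None
              then run_within (LEAST n. run_within n f A \<noteq> None) f A else None)"


section \<open>The class of target distributions\<close>

definition target_class :: "real \<Rightarrow> real \<Rightarrow> real measure \<Rightarrow> (real \<Rightarrow> real) \<Rightarrow> bool" where
  "target_class \<alpha> \<beta> p V \<longleftrightarrow>
     prob_space p \<and> p = density lborel (\<lambda>x. ennreal (exp (- V x))) \<and>
     (\<exists>V' V''. (\<forall>x. (V has_real_derivative V' x) (at x)) \<and>
               (\<forall>x. (V' has_real_derivative V'' x) (at x)) \<and>
               continuous_on UNIV V'' \<and>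
               (\<forall>x. \<alpha> \<le> V'' x \<and> V'' x \<le> \<beta>) \<and>
               V' 0 = 0)"

text \<open>The potential after preprocessing: \<open>1 \<le> V'' \<le> \<beta> / \<alpha>\<close> and \<open>V 0 = 0\<close>.\<close>

definition rescaled_potential :: "real \<Rightarrow> (real \<Rightarrow> real) \<Rightarrow> real \<Rightarrow> real" where
  "rescaled_potential \<alpha> V x = V (x / sqrt \<alpha>) - V 0"


section \<open>Building the envelope\<close>

definition envelope_fun :: "real \<Rightarrow> real \<Rightarrow> real \<Rightarrow> real" where
  "envelope_fun x\<^sub>m x\<^sub>p x =
     (if x \<le> x\<^sub>m then exp (- ((x - x\<^sub>m) / (2 * x\<^sub>m)) - (x - x\<^sub>m)\<^sup>2 / 2)
      else if x \<le> x\<^sub>p then 1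
      else exp (- ((x - x\<^sub>p) / (2 * x\<^sub>p)) - (x - x\<^sub>p)\<^sup>2 / 2))"

text \<open>
  Binary search in \<open>{lo..hi}\<close> for the first index whose point \<open>pt i\<close> has an answer satisfying
  \<open>P\<close>, provided that \<open>P\<close> is monotone along the indices and holds at \<open>hi\<close>, which is therefore
  never queried. The index found is passed to the continuation \<open>k\<close>.
\<close>

function binary_search ::
  "(nat \<Rightarrow> real) \<Rightarrow> (real \<Rightarrow> bool) \<Rightarrow> nat \<Rightarrow> nat \<Rightarrow> (nat \<Rightarrow> 'a oracle_alg) \<Rightarrow> 'a oracle_alg" where
  "binary_search pt P lo hi k =
     (if hi \<le> lo then k lo
      else let mid = (lo + hi) div 2
           in Query (pt mid) (\<lambda>v. if P v then binary_search pt P lo mid k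
                                  else binary_search pt P (Suc mid) hi k))"
  by pat_completeness auto
termination
  by (relation "Wellfounded.measure (\<lambda>(pt, P, lo, hi, k). hi - lo)") auto

declare binary_search.simps [simp del]

definition max_index :: "real \<Rightarrow> nat" where
  "max_index \<kappa> = nat \<lceil>log 2 \<kappa> / 2\<rceil>"

text \<open>
  The algorithm ENVELOPE. Points \<open>x\<close> of the rescaled problem are queried at \<open>x / sqrt \<alpha>\<close>, and
  answers are compared after subtracting the answer \<open>v\<^sub>0\<close> at \<open>0\<close>. The latter is returned along
  with the envelope, since evaluating the unnormalized target with one query needs it.
\<close>

definition ENVELOPE :: "real \<Rightarrow> real \<Rightarrow> (real \<times> (real \<Rightarrow> real)) oracle_alg" where
  "ENVELOPE \<alpha> \<beta> =
     (let \<kappa> = \<beta> / \<alpha>; N = max_index \<kappa> in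
      Query 0 (\<lambda>v\<^sub>0.
        binary_search (\<lambda>i. (2 ^ i / sqrt \<kappa>) / sqrt \<alpha>) (\<lambda>v. v - v\<^sub>0 \<ge> 1 / 2) 0 N (\<lambda>i\<^sub>p.
          binary_search (\<lambda>i. - (2 ^ i / sqrt \<kappa>) / sqrt \<alpha>) (\<lambda>v. v - v\<^sub>0 \<ge> 1 / 2) 0 N (\<lambda>i\<^sub>m.
            Return (v\<^sub>0, envelope_fun (- (2 ^ i\<^sub>m / sqrt \<kappa>)) (2 ^ i\<^sub>p / sqrt \<kappa>))))))"

text \<open>
  The first index at which the rescaled potential \<open>W\<close>, along direction \<open>s = 1\<close> or \<open>s = -1\<close>,
  reaches \<open>1 / 2\<close>.
\<close>

definition first_index :: "real \<Rightarrow> (real \<Rightarrow> real) \<Rightarrow> real \<Rightarrow> nat \<Rightarrow> bool" where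
  "first_index \<kappa> W s i \<longleftrightarrow>
     i \<le> max_index \<kappa> \<and> W (s * (2 ^ i / sqrt \<kappa>)) \<ge> 1 / 2 \<and>
     (\<forall>j<i. W (s * (2 ^ j / sqrt \<kappa>)) < 1 / 2)"


section \<open>Rejection sampling\<close>

text \<open>
  The random input of SAMPLE: an i.i.d. sequence of pairs \<open>(X, U)\<close> with \<open>X\<close> distributed
  according to the normalized envelope and \<open>U\<close> uniform on \<open>[0, 1]\<close>, independent of \<open>X\<close>.
\<close>

definition proposal :: "(real \<Rightarrow> real) \<Rightarrow> real measure" where
  "proposal q = density lborel (\<lambda>x. ennreal (q x / (\<integral>y. q y \<partial>lborel)))"

definition draws :: "(real \<Rightarrow> real) \<Rightarrow> (real \<times> real) stream measure" where
  "draws q = stream_space (proposal q \<Otimes>\<^sub>M uniform_measure lborel {0..1})"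

text \<open>
  The algorithm SAMPLE, for a fixed outcome of its draws. A proposal is accepted with
  probability \<open>exp (- (v - v\<^sub>0)) / q X\<close> by comparing this ratio with \<open>U\<close>; the accepted point is
  scaled back to a sample for the original target.
\<close>

primcorec SAMPLE ::
  "real \<Rightarrow> real \<Rightarrow> (real \<Rightarrow> real) \<Rightarrow> (real \<times> real) stream \<Rightarrow> real oracle_alg" where
  "SAMPLE \<alpha> v\<^sub>0 q \<omega> =
     Query (fst (shd \<omega>) / sqrt \<alpha>) (\<lambda>v.
       if snd (shd \<omega>) \<le> exp (- (v - v\<^sub>0)) / q (fst (shd \<omega>))
       then Return (fst (shd \<omega>) / sqrt \<alpha>)
       else SAMPLE \<alpha> v\<^sub>0 q (stl \<omega>))"


section \<open>Distributions on the reals with a failure symbol\<close>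

text \<open>The disjoint union of the Borel line and the point \<open>None\<close>, as a measurable space.\<close>

definition borel_failure :: "real option measure" where
  "borel_failure = sigma UNIV {A. Some -` A \<in> sets borel}"

definition with_failure :: "real measure \<Rightarrow> real option measure" where
  "with_failure \<mu> = distr \<mu> borel_failure Some"

text \<open>For measures \<open>\<mu>\<close> and \<open>\<nu>\<close> with the same measurable sets.\<close>

definition tv_dist :: "'a measure \<Rightarrow> 'a measure \<Rightarrow> real" where
  "tv_dist \<mu> \<nu> = (SUP A\<in>sets \<mu>. \<bar>measure \<mu> A - measure \<nu> A\<bar>)"

end

theory Submission
  imports Defs
begin

text \<open>
  Let \<open>W\<close> be the rescaled potential, so that \<open>1 \<le> W'' \<le> \<kappa>\<close>, \<open>W 0 = 0\<close> and \<open>W' 0 = 0\<close>. Since \<open>W\<close> increases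
  away from the mode on both sides and \<open>x\<^sup>2 / 2 \<le> W x \<le> \<kappa> * x\<^sup>2 / 2\<close>, it reaches the level \<open>1 / 2\<close> at a distance
  between \<open>1 / sqrt \<kappa>\<close> and \<open>1\<close> from the mode. The geometric grid \<open>2 ^ i / sqrt \<kappa>\<close> covers this range
  with \<open>O (1 + log \<kappa>)\<close> points, and binary search on it finds, with \<open>O (1 + log (1 + log \<kappa>))\<close> queries, points
  \<open>xm < 0 < xp\<close> that overshoot the crossing by a factor of at most two (\<open>binary_search_finds_first\<close>,
  \<open>W_half_le\<close>).

  These points control both the target and the envelope. At \<open>y = xm, xp\<close>, \<open>W\<close> has value at least \<open>1 / 2\<close> and
  outward slope at least \<open>1 / (2 * \<bar>y\<bar>)\<close>, so beyond them strong convexity puts \<open>exp (- W)\<close> below the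
  tails of the envelope (\<open>envelope_ge\<close>). These tails decay at a rate inverse to \<open>\<bar>y\<bar>\<close>, so the envelope has
  mass at most \<open>3 * (xp - xm)\<close> (\<open>nn_integral_envelope_le\<close>). On \<open>{xm / 2..xp / 2}\<close>, in turn,
  \<open>W \<le> 1 / 2\<close>, so \<open>exp (- W)\<close> has mass at least \<open>(xp - xm) / 4\<close> (\<open>nn_integral_exp_W_ge\<close>). A proposal is
  therefore accepted with probability \<open>a \<ge> 1 / 12\<close>, whatever \<open>\<kappa>\<close> is (\<open>a_ge\<close>).

  The rest holds for every rejection sampler. Conditioning on the first draw gives
  \<open>\<mu> = a \<cdot> p + (1 - a) \<cdot> \<mu>\<close> for the distribution \<open>\<mu>\<close> of the output, hence \<open>\<mu> = p\<close> (\<open>distr_run\<close>); the number of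
  queries is geometric with mean \<open>1 / a \<le> 12\<close> (\<open>expected_num_queries\<close>); and with \<open>n\<close> queries the distance
  to \<open>p\<close> is at most the failure probability \<open>(1 - a) ^ n \<le> exp (- n / 12)\<close> (\<open>tv_dist_run_within\<close>), which is at
  most \<open>\<epsilon>\<close> once \<open>n \<ge> 12 * ln (1 / \<epsilon>)\<close>. Thus \<open>C = 12\<close> serves all three claims.
\<close>

section \<open>Runs of oracle algorithms and binary search\<close>

lemma run_within_Return: "run_within n f (Return a) = Some a"
  by (cases n) simp_all

lemma run_within_mono:
  assumes "run_within n f A = Some a" "n \<le> m"
  shows "run_within m f A = Some a"
  using assms
proof (induction n arbitrary: A m)
  case 0
  then show ?case by (cases m) (auto split: oracle_alg.splits)
next
  case (Suc n)
  then show ?case by (cases m) (auto split: oracle_alg.splits)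
qed

lemma run_eq_run_within:
  assumes "run_within n f A = Some a"
  shows "run f A = Some a"
proof -
  define l where "l = (LEAST n. run_within n f A \<noteq> None)"
  have ex: "\<exists>n. run_within n f A \<noteq> None" using assms by auto
  then have "run_within l f A \<noteq> None" unfolding l_def by (rule LeastI_ex)
  moreover have "l \<le> n" unfolding l_def by (rule Least_le) (simp add: assms)
  ultimately have "run_within l f A = Some a"
    using run_within_mono[of l f A _ n] assms by fastforce
  then show ?thesis using ex by (simp add: run_def l_def)
qed

lemma num_queries_le:
  assumes "run_within n f A \<noteq> None"
  shows "num_queries f A \<le> enat n"
  unfolding num_queries_def by (rule INF_lower) (use assms in simp)

text \<open>
  The expected number of queries is computed as a sum of tail probabilities. This form also
  reduces its measurability to that of the runs with a budget.
\<close>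

lemma num_queries_eq_suminf:
  "ennreal_of_enat (num_queries f A) = (\<Sum>n. if run_within n f A = None then 1 else 0)"
proof (cases "\<exists>n. run_within n f A \<noteq> None")
  case True
  define l where "l = (LEAST n. run_within n f A \<noteq> None)"
  have l: "run_within l f A \<noteq> None" unfolding l_def using True by (rule LeastI_ex)
  have iff: "run_within n f A = None \<longleftrightarrow> n < l" for n
  proof
    assume "n < l"
    then show "run_within n f A = None" using not_less_Least unfolding l_def by blast
  next
    assume "run_within n f A = None"
    then show "n < l" using l run_within_mono[of l f A _ n] by (fastforce simp: not_less)
  qed
  have "num_queries f A = enat l"
  proof (rule antisym)
    show "enat l \<le> num_queries f A"
      unfolding num_queries_def by (rule INF_greatest) (use iff in \<open>auto simp: not_less\<close>)
  qed (rule num_queries_le[OF l])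
  moreover have "(\<Sum>n. if run_within n f A = None then 1 else 0 :: ennreal)
      = (\<Sum>n<l. if run_within n f A = None then 1 else 0)"
    by (rule suminf_finite) (auto simp: iff)
  ultimately show ?thesis by (simp add: iff)
next
  case False
  then have none: "run_within n f A = None" for n by auto
  have "num_queries f A = \<infinity>" by (simp add: num_queries_def none top_enat_def)
  moreover have "(\<Sum>n::nat. 1::ennreal) = \<infinity>"
    by (simp add: suminf_eq_SUP ennreal_SUP_of_nat_eq_top)
  ultimately show ?thesis by (simp add: none)
qed

lemma binary_search_singleton: "binary_search pt P i i k = k i"
  by (subst binary_search.simps) simp

text \<open>
  The range halves with every query: both \<open>{lo..mid}\<close> and \<open>{Suc mid..hi}\<close> contain at most half
  of the indices (rounded up), so \<open>2 ^ d\<close> candidates need at most \<open>d\<close> queries. The count \<open>m\<close> is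
  independent of the remaining budget \<open>r\<close>, so that the costs of consecutive searches add up.
\<close>

lemma binary_search_finds_first:
  assumes "lo \<le> hi" "hi - lo < 2 ^ d" "P (f (pt hi))"
    and "\<forall>i j. i \<le> j \<longrightarrow> j \<le> hi \<longrightarrow> P (f (pt i)) \<longrightarrow> P (f (pt j))"
  shows "\<exists>i m. lo \<le> i \<and> i \<le> hi \<and> P (f (pt i)) \<and> (\<forall>j. lo \<le> j \<longrightarrow> j < i \<longrightarrow> \<not> P (f (pt j))) \<and>
    m \<le> d \<and> (\<forall>r. run_within (m + r) f (binary_search pt P lo hi k) = run_within r f (k i))"
  using assms
proof (induction d arbitrary: lo hi)
  case 0
  have "hi = lo" using 0 by simp
  show ?case
    by (rule exI[of _ lo], rule exI[of _ 0])
      (use 0 \<open>hi = lo\<close> in \<open>auto simp: binary_search_singleton\<close>)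
next
  case (Suc d)
  show ?case
  proof (cases "hi = lo")
    case True
    show ?thesis
      by (rule exI[of _ lo], rule exI[of _ 0])
        (use True Suc.prems in \<open>auto simp: binary_search_singleton\<close>)
  next
    case False
    define mid where "mid = (lo + hi) div 2"
    have mid: "lo \<le> mid" "mid < hi" "mid - lo < 2 ^ d" "hi - Suc mid < 2 ^ d"
      using False Suc.prems(1,2) by (auto simp: mid_def)
    show ?thesis
    proof (cases "P (f (pt mid))")
      case True
      have step: "run_within (Suc n) f (binary_search pt P lo hi k)
          = run_within n f (binary_search pt P lo mid k)" for n
        using True False Suc.prems(1)
        by (subst binary_search.simps) (simp add: mid_def Let_def)
      have mono: "\<forall>i j. i \<le> j \<longrightarrow> j \<le> mid \<longrightarrow> P (f (pt i)) \<longrightarrow> P (f (pt j))"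
        using Suc.prems(4) mid(2) by simp
      obtain i m where i: "lo \<le> i" "i \<le> mid" "P (f (pt i))"
          "\<forall>j. lo \<le> j \<longrightarrow> j < i \<longrightarrow> \<not> P (f (pt j))" "m \<le> d"
          "\<forall>r. run_within (m + r) f (binary_search pt P lo mid k) = run_within r f (k i)"
        using Suc.IH[OF mid(1) mid(3) True mono] by blast
      show ?thesis
        by (rule exI[of _ i], rule exI[of _ "Suc m"])
          (use mid i in \<open>auto simp: step simp del: run_within.simps\<close>)
    next
      case nP: False
      have step: "run_within (Suc n) f (binary_search pt P lo hi k)
          = run_within n f (binary_search pt P (Suc mid) hi k)" for n
        using nP False Suc.prems(1)
        by (subst binary_search.simps) (simp add: mid_def Let_def)
      obtain i m where i: "Suc mid \<le> i" "i \<le> hi" "P (f (pt i))"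
          "\<forall>j. Suc mid \<le> j \<longrightarrow> j < i \<longrightarrow> \<not> P (f (pt j))" "m \<le> d"
          "\<forall>r. run_within (m + r) f (binary_search pt P (Suc mid) hi k) = run_within r f (k i)"
        using Suc.IH[OF Suc_leI[OF mid(2)] mid(4) Suc.prems(3,4)] by blast
      have before: "\<not> P (f (pt j))" if "j < i" for j
      proof (cases "j \<le> mid")
        case True
        then show ?thesis using nP Suc.prems(4)[rule_format, of j mid] mid(2) by auto
      next
        case False
        then show ?thesis using i(4) that by simp
      qed
      show ?thesis
        by (rule exI[of _ i], rule exI[of _ "Suc m"])
          (use mid i before in \<open>auto simp: step simp del: run_within.simps\<close>)
    qed
  qed
qed

section \<open>Rejection sampling\<close>

text \<open>
  The generating sets already form a sigma-algebra, hence nothing is added by generation.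
\<close>

lemma sets_borel_failure: "sets borel_failure = {A. Some -` A \<in> sets borel}"
proof -
  have "sigma_algebra UNIV {A :: real option set. Some -` A \<in> sets borel}"
    by (auto simp: sigma_algebra_iff2 vimage_Compl Compl_eq_Diff_UNIV[symmetric] vimage_UN)
  then show ?thesis
    unfolding borel_failure_def by (rule sigma_algebra.sets_measure_of_eq)
qed

lemma space_borel_failure: "space borel_failure = UNIV"
  by (simp add: borel_failure_def space_measure_of_conv)

lemma measurable_Some: "Some \<in> borel \<rightarrow>\<^sub>M borel_failure"
  by (rule measurableI) (auto simp: sets_borel_failure space_borel_failure)

lemma measurable_eq_None: "Measurable.pred borel_failure (\<lambda>y. y = None)"
  unfolding pred_def by (simp add: sets_borel_failure space_borel_failure vimage_def)

lemma emeasure_with_failure: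
  assumes "sets p = sets borel" "B \<in> sets borel_failure"
  shows "emeasure (with_failure p) B = emeasure p (Some -` B)"
proof -
  have "space p = UNIV" using sets_eq_imp_space_eq[OF assms(1)] by simp
  moreover have "Some \<in> p \<rightarrow>\<^sub>M borel_failure"
    using measurable_Some measurable_cong_sets[OF assms(1) refl] by blast
  ultimately show ?thesis unfolding with_failure_def using assms(2)
    by (simp add: emeasure_distr)
qed

lemma emeasure_distr_eq_nn_integral:
  assumes [measurable]: "R \<in> M \<rightarrow>\<^sub>M N" "B \<in> sets N"
  shows "emeasure (distr M N R) B = (\<integral>\<^sup>+\<omega>. indicator B (R \<omega>) \<partial>M)"
proof -
  have "(\<integral>\<^sup>+y. indicator B y \<partial>distr M N R) = (\<integral>\<^sup>+\<omega>. indicator B (R \<omega>) \<partial>M)"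
    by (rule nn_integral_distr) measurable
  then show ?thesis by simp
qed

text \<open>
  Rejection sampling from i.i.d. draws in \<open>M\<close>. The assumption \<open>prob_acc\<close> says that a single draw
  is accepted with probability \<open>a\<close> and that, given acceptance, the output has distribution \<open>p\<close>. Of
  the algorithm only its one-step recursion is used.
\<close>

locale rejection_sampling = prob_space M for M :: "'z measure" +
  fixes acc :: "'z \<Rightarrow> bool" and out :: "'z \<Rightarrow> real" and a :: real and p :: "real measure"
    and f :: "real \<Rightarrow> real" and alg :: "'z stream \<Rightarrow> real oracle_alg"
  assumes p: "prob_space p" "sets p = sets borel"
    and acc [measurable]: "Measurable.pred M acc"
    and out [measurable]: "out \<in> borel_measurable M"
    and prob_acc: "A \<in> sets borel \<Longrightarrow> prob {z \<in> space M. acc z \<and> out z \<in> A} = a * measure p A"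
    and a_pos: "0 < a"
    and alg_0: "run_within 0 f (alg \<omega>) = None"
    and alg_Suc: "run_within (Suc n) f (alg \<omega>) =
      (if acc (shd \<omega>) then Some (out (shd \<omega>)) else run_within n f (alg (stl \<omega>)))"
begin

abbreviation (input) "D \<equiv> stream_space M"

lemma space_p: "space p = UNIV"
  using sets_eq_imp_space_eq[OF p(2)] by simp

lemma prob_space_with_failure: "prob_space (with_failure p)"
  unfolding with_failure_def
  by (rule prob_space.prob_space_distr[OF p(1)])
    (use measurable_Some measurable_cong_sets[OF p(2) refl] in blast)

lemma sets_with_failure: "sets (with_failure p) = sets borel_failure"
  by (simp add: with_failure_def)

lemma prob_first_accepted:
  assumes "B \<in> sets borel_failure"
  shows "emeasure M {z \<in> space M. acc z \<and> Some (out z) \<in> B} = ennreal (a * measure (with_failure p) B)"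
proof -
  have "measure (with_failure p) B = measure p (Some -` B)"
    using emeasure_with_failure[OF p(2) assms] by (simp add: measure_def)
  then show ?thesis
    using prob_acc[of "Some -` B"] assms by (simp add: sets_borel_failure emeasure_eq_measure)
qed

lemma a_le_1: "a \<le> 1"
  using prob_acc[of UNIV] prob_space.prob_space[OF p(1)] prob_le_1
  by (metis (no_types, lifting) mult.right_neutral sets.top space_borel space_p)

lemma prob_rejected: "emeasure M {z \<in> space M. \<not> acc z} = ennreal (1 - a)"
proof -
  have "prob {z \<in> space M. acc z} = a"
    using prob_acc[of UNIV] prob_space.prob_space[OF p(1)] by (simp add: space_p)
  then show ?thesis by (simp add: prob_neg emeasure_eq_measure)
qed

lemma measurable_run_within [measurable]:
  "(\<lambda>\<omega>. run_within n f (alg \<omega>)) \<in> D \<rightarrow>\<^sub>M borel_failure"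
proof (induction n)
  case 0
  show ?case unfolding alg_0 by (simp add: space_borel_failure)
next
  case (Suc n)
  note Suc [measurable] measurable_Some [measurable]
  show ?case unfolding alg_Suc by measurable
qed

lemma measurable_run_within_None [measurable]:
  "Measurable.pred D (\<lambda>\<omega>. run_within n f (alg \<omega>) = None)"
  using measurable_compose[OF measurable_run_within measurable_eq_None] .

lemma measurable_run [measurable]: "(\<lambda>\<omega>. run f (alg \<omega>)) \<in> D \<rightarrow>\<^sub>M borel_failure"
proof -
  have [measurable]: "(\<lambda>\<omega>. run_within (LEAST n. run_within n f (alg \<omega>) \<noteq> None) f (alg \<omega>)) \<in> D \<rightarrow>\<^sub>M borel_failure"
    by (rule measurable_compose_countable[OF measurable_run_within]) measurable
  have [measurable]: "(\<lambda>\<omega>. None) \<in> D \<rightarrow>\<^sub>M borel_failure"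
    by (simp add: space_borel_failure)
  show ?thesis unfolding run_def by measurable
qed

lemma measurable_num_queries:
  "(\<lambda>\<omega>. ennreal_of_enat (num_queries f (alg \<omega>))) \<in> borel_measurable D"
  unfolding num_queries_eq_suminf by measurable

text \<open>
  The unbounded run satisfies the same recursion as the bounded ones. This is what identifies
  its distribution without passing to a limit.
\<close>

lemma run_step:
  "run f (alg \<omega>) = (if acc (shd \<omega>) then Some (out (shd \<omega>)) else run f (alg (stl \<omega>)))"
proof (cases "acc (shd \<omega>)")
  case True
  then show ?thesis using run_eq_run_within[of 1 f "alg \<omega>"] alg_Suc[of 0] by simp
next
  case False
  show ?thesis
  proof (cases "run f (alg (stl \<omega>))")
    case None
    then have "run_within n f (alg (stl \<omega>)) = None" for n
      using run_eq_run_within by (metis not_Some_eq option.distinct(1))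
    then have "run_within n f (alg \<omega>) = None" for n
      using False by (cases n) (simp_all only: alg_0 alg_Suc if_False)
    then show ?thesis using False None by (simp add: run_def)
  next
    case (Some y)
    then obtain n where "run_within n f (alg (stl \<omega>)) = Some y"
      unfolding run_def by (meson option.distinct(1))
    then have "run_within (Suc n) f (alg \<omega>) = Some y"
      using False by (simp only: alg_Suc if_False)
    from run_eq_run_within[OF this] show ?thesis using False Some by simp
  qed
qed

text \<open>
  Condition on the first draw: the tail of the stream is again an i.i.d. stream, independent of
  the head. The runs \<open>R\<close> and \<open>S\<close> are separate so that the lemma covers both a step of the budget
  (\<open>R\<close> with \<open>n + 1\<close> queries, \<open>S\<close> with \<open>n\<close>) and the unbounded run (\<open>R = S\<close>).
\<close>

lemma distr_step:
  assumes [measurable]: "R \<in> D \<rightarrow>\<^sub>M borel_failure" "S \<in> D \<rightarrow>\<^sub>M borel_failure"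
    and R: "\<And>\<omega>. R \<omega> = (if acc (shd \<omega>) then Some (out (shd \<omega>)) else S (stl \<omega>))"
    and B [measurable]: "B \<in> sets borel_failure"
  shows "measure (distr D borel_failure R) B
    = a * measure (with_failure p) B + (1 - a) * measure (distr D borel_failure S) B"
proof -
  interpret D: prob_space D by (rule prob_space_stream_space)
  interpret R: prob_space "distr D borel_failure R" by (rule D.prob_space_distr) measurable
  interpret S: prob_space "distr D borel_failure S" by (rule D.prob_space_distr) measurable
  have [measurable]: "{z \<in> space M. acc z \<and> Some (out z) \<in> B} \<in> sets M"
    using measurable_Some [measurable] by measurable
  let ?b = "emeasure (distr D borel_failure S) B"
  have "emeasure (distr D borel_failure R) B = (\<integral>\<^sup>+\<omega>. indicator B (R \<omega>) \<partial>D)"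
    by (rule emeasure_distr_eq_nn_integral) measurable
  also have "\<dots> = (\<integral>\<^sup>+z. \<integral>\<^sup>+\<omega>. indicator B (R (z ## \<omega>)) \<partial>D \<partial>M)"
    by (rule nn_integral_stream_space) measurable
  also have "\<dots> = (\<integral>\<^sup>+z. indicator {z \<in> space M. acc z \<and> Some (out z) \<in> B} z
      + ?b * indicator {z \<in> space M. \<not> acc z} z \<partial>M)"
  proof (rule nn_integral_cong)
    fix z assume "z \<in> space M"
    moreover have "(\<integral>\<^sup>+\<omega>. indicator B (S \<omega>) \<partial>D) = ?b"
      by (rule emeasure_distr_eq_nn_integral[symmetric]) measurable
    ultimately show "(\<integral>\<^sup>+\<omega>. indicator B (R (z ## \<omega>)) \<partial>D)
      = indicator {z \<in> space M. acc z \<and> Some (out z) \<in> B} z + ?b * indicator {z \<in> space M. \<not> acc z} z"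
      using D.emeasure_space_1 by (auto simp: R indicator_def)
  qed
  also have "\<dots> = ennreal (a * measure (with_failure p) B) + ?b * ennreal (1 - a)"
    by (simp add: nn_integral_add nn_integral_cmult prob_first_accepted prob_rejected)
  also have "\<dots> = ennreal (a * measure (with_failure p) B + (1 - a) * measure (distr D borel_failure S) B)"
    using a_pos a_le_1 by (simp add: S.emeasure_eq_measure ennreal_mult[symmetric] mult.commute
        flip: ennreal_plus)
  finally show ?thesis
    using a_pos a_le_1 unfolding R.emeasure_eq_measure by (subst (asm) ennreal_inj) auto
qed

text \<open>
  With \<open>R = S\<close> the one-step identity reads \<open>\<mu> = a \<cdot> p + (1 - a) \<cdot> \<mu>\<close>. As \<open>a\<close> is positive and all
  quantities are finite, \<open>\<mu> = p\<close>; in particular the run returns almost surely.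
\<close>

lemma distr_run: "distr D borel_failure (\<lambda>\<omega>. run f (alg \<omega>)) = with_failure p"
proof (rule measure_eqI)
  interpret D: prob_space D by (rule prob_space_stream_space)
  interpret R: prob_space "distr D borel_failure (\<lambda>\<omega>. run f (alg \<omega>))"
    by (rule D.prob_space_distr) measurable
  interpret P: prob_space "with_failure p" by (rule prob_space_with_failure)
  fix B assume "B \<in> sets (distr D borel_failure (\<lambda>\<omega>. run f (alg \<omega>)))"
  then have "B \<in> sets borel_failure" by simp
  from distr_step[OF measurable_run measurable_run run_step this]
  have "a * measure (distr D borel_failure (\<lambda>\<omega>. run f (alg \<omega>))) B = a * measure (with_failure p) B"
    by (simp add: algebra_simps)
  then show "emeasure (distr D borel_failure (\<lambda>\<omega>. run f (alg \<omega>))) B = emeasure (with_failure p) B"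
    using a_pos by (simp add: R.emeasure_eq_measure P.emeasure_eq_measure)
qed (simp add: sets_with_failure)

lemma measure_run_within:
  assumes "B \<in> sets borel_failure"
  shows "measure (distr D borel_failure (\<lambda>\<omega>. run_within n f (alg \<omega>))) B
    = (1 - (1 - a) ^ n) * measure (with_failure p) B + (1 - a) ^ n * indicator B None"
proof (induction n)
  case 0
  interpret D: prob_space D by (rule prob_space_stream_space)
  have "(\<lambda>\<omega>. None :: real option) -` B \<inter> space D = (if None \<in> B then space D else {})" by auto
  then show ?case using assms D.prob_space
    by (simp add: alg_0 measure_def emeasure_distr space_borel_failure indicator_def
        del: run_within.simps)
next
  case (Suc n)
  show ?case
    by (subst distr_step[OF measurable_run_within measurable_run_within alg_Suc assms])
      (simp add: Suc algebra_simps)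
qed

text \<open>
  The output with budget \<open>n\<close> is the mixture of \<open>p\<close> and the point mass at failure, the latter with
  weight \<open>(1 - a) ^ n\<close>; replacing that part by \<open>p\<close> moves at most this much mass.
\<close>

lemma tv_dist_run_within:
  "tv_dist (distr D borel_failure (\<lambda>\<omega>. run_within n f (alg \<omega>))) (with_failure p) \<le> (1 - a) ^ n"
  unfolding tv_dist_def
proof (rule cSUP_least)
  interpret P: prob_space "with_failure p" by (rule prob_space_with_failure)
  fix B assume "B \<in> sets (distr D borel_failure (\<lambda>\<omega>. run_within n f (alg \<omega>)))"
  then have "B \<in> sets borel_failure" by simp
  then have "measure (distr D borel_failure (\<lambda>\<omega>. run_within n f (alg \<omega>))) B - measure (with_failure p) B
    = (1 - a) ^ n * (indicator B None - measure (with_failure p) B)"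
    by (simp add: measure_run_within algebra_simps)
  moreover have "\<bar>indicator B None - measure (with_failure p) B\<bar> \<le> 1"
    using P.prob_le_1[of B] measure_nonneg[of "with_failure p" B] by (auto simp: indicator_def)
  moreover have "0 \<le> (1 - a) ^ n" using a_le_1 by simp
  ultimately show "\<bar>measure (distr D borel_failure (\<lambda>\<omega>. run_within n f (alg \<omega>))) B
      - measure (with_failure p) B\<bar> \<le> (1 - a) ^ n"
    by (simp add: abs_mult mult_left_le)
qed auto

lemma expected_num_queries:
  "(\<integral>\<^sup>+\<omega>. ennreal_of_enat (num_queries f (alg \<omega>)) \<partial>D) = ennreal (1 / a)"
proof -
  interpret D: prob_space D by (rule prob_space_stream_space)
  have none: "{None} \<in> sets borel_failure" by (simp add: sets_borel_failure vimage_def)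
  have "(\<integral>\<^sup>+\<omega>. (if run_within n f (alg \<omega>) = None then 1 else 0) \<partial>D) = ennreal ((1 - a) ^ n)" for n
  proof -
    have "(\<integral>\<^sup>+\<omega>. (if run_within n f (alg \<omega>) = None then 1 else 0) \<partial>D)
      = (\<integral>\<^sup>+y. indicator {None} y \<partial>distr D borel_failure (\<lambda>\<omega>. run_within n f (alg \<omega>)))"
      using none by (subst nn_integral_distr) (auto simp: indicator_def intro!: nn_integral_cong)
    also have "\<dots> = emeasure (distr D borel_failure (\<lambda>\<omega>. run_within n f (alg \<omega>))) {None}"
      using none by simp
    also have "\<dots> = ennreal (measure (distr D borel_failure (\<lambda>\<omega>. run_within n f (alg \<omega>))) {None})"
      by (rule finite_measure.emeasure_eq_measure)
        (auto intro!: prob_space.finite_measure D.prob_space_distr)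
    also have "measure (with_failure p) {None} = 0"
      using emeasure_with_failure[OF p(2) none] by (simp add: measure_def vimage_def)
    ultimately show ?thesis by (simp add: measure_run_within none)
  qed
  then have "(\<integral>\<^sup>+\<omega>. ennreal_of_enat (num_queries f (alg \<omega>)) \<partial>D) = (\<Sum>n. ennreal ((1 - a) ^ n))"
    unfolding num_queries_eq_suminf by (subst nn_integral_suminf) auto
  also have "\<dots> = ennreal (1 / a)"
    using a_pos a_le_1 geometric_sums[of "1 - a"]
    by (subst suminf_ennreal_eq[where x = "1 / a"]) auto
  finally show ?thesis .
qed

end

section \<open>Potentials that are strongly convex and smooth\<close>

locale potential =
  fixes W W' W'' :: "real \<Rightarrow> real" and \<kappa> :: real
  assumes deriv: "\<And>x. (W has_real_derivative W' x) (at x)"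
    and deriv2: "\<And>x. (W' has_real_derivative W'' x) (at x)"
    and W''_ge: "\<And>x. 1 \<le> W'' x"
    and W''_le: "\<And>x. W'' x \<le> \<kappa>"
    and mode: "W' 0 = 0"
    and W_0: "W 0 = 0"
begin

lemma kappa_ge_1: "1 \<le> \<kappa>"
  using W''_ge[of 0] W''_le[of 0] by linarith

lemma taylor: "\<exists>t. W y = W x + W' x * (y - x) + W'' t / 2 * (y - x)\<^sup>2"
proof (cases "y = x")
  case False
  define diff where "diff = (\<lambda>n::nat. if n = 0 then W else if n = 1 then W' else W'')"
  have "\<exists>t. (if y < x then y < t \<and> t < x else x < t \<and> t < y) \<and>
    W y = (\<Sum>m<2. (diff m x / fact m) * (y - x) ^ m) + (diff 2 t / fact 2) * (y - x) ^ 2"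
    by (rule Taylor[where a = "min x y" and b = "max x y"])
      (use False deriv deriv2 in \<open>auto simp: diff_def less_2_cases_iff\<close>)
  then show ?thesis by (auto simp: diff_def numeral_2_eq_2)
qed (auto intro: exI[of _ x])

lemma strong_convexity: "W x + W' x * (y - x) + (y - x)\<^sup>2 / 2 \<le> W y"
proof -
  obtain t where "W y = W x + W' x * (y - x) + W'' t / 2 * (y - x)\<^sup>2" using taylor by blast
  moreover have "1 * (y - x)\<^sup>2 \<le> W'' t * (y - x)\<^sup>2" by (rule mult_right_mono) (use W''_ge in auto)
  ultimately show ?thesis by simp
qed

lemma tangent_le: "W x + W' x * (y - x) \<le> W y"
  using strong_convexity[of x y] zero_le_power2[of "y - x"] by linarith

lemma W_ge: "x\<^sup>2 / 2 \<le> W x"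
  using strong_convexity[of 0 x] by (simp add: mode W_0)

lemma W_nonneg: "0 \<le> W x"
  using W_ge[of x] by (smt (verit) zero_le_power2 divide_nonneg_nonneg)

lemma W_le: "W x \<le> \<kappa> * x\<^sup>2 / 2"
proof -
  obtain t where "W x = W'' t / 2 * x\<^sup>2" using taylor[of x 0] by (auto simp: mode W_0)
  moreover have "W'' t * x\<^sup>2 \<le> \<kappa> * x\<^sup>2" by (rule mult_right_mono) (use W''_le in auto)
  ultimately show ?thesis by simp
qed

text \<open>
  A convex function with its minimum at \<open>0\<close> is monotone along every ray from \<open>0\<close>. Averaging the
  tangent inequality at \<open>l * x\<close>, taken at the points \<open>x\<close> and \<open>0\<close> with weights \<open>l\<close> and \<open>1 - l\<close>,
  eliminates the slope. Arguing by rays treats both half-lines at once.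
\<close>

lemma W_scale_le:
  assumes "0 \<le> l" "l \<le> 1"
  shows "W (l * x) \<le> W x"
proof -
  let ?z = "l * x"
  have "W ?z + W' ?z * (x - ?z) \<le> W x" "W ?z - W' ?z * ?z \<le> 0"
    using tangent_le[of ?z x] tangent_le[of ?z 0] by (simp_all add: W_0)
  then have "l * (W ?z + W' ?z * (x - ?z)) + (1 - l) * (W ?z - W' ?z * ?z) \<le> l * W x + (1 - l) * 0"
    using assms by (intro add_mono mult_left_mono) auto
  then have "W ?z \<le> l * W x" by (simp add: algebra_simps)
  also have "\<dots> \<le> 1 * W x" by (rule mult_right_mono) (use assms W_nonneg in auto)
  finally show ?thesis by simp
qed

lemma W_grid_mono:
  assumes "i \<le> j"
  shows "W (s * (2 ^ i / sqrt \<kappa>)) \<le> W (s * (2 ^ j / sqrt \<kappa>))"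
proof -
  have eq: "s * (2 ^ i / sqrt \<kappa>) = (2 ^ i / 2 ^ j) * (s * (2 ^ j / sqrt \<kappa>))" by simp
  have "(2 ^ i / 2 ^ j :: real) \<le> 1" using assms by (simp add: power_increasing)
  then show ?thesis unfolding eq by (intro W_scale_le) auto
qed

text \<open>
  The last grid point is at distance at least \<open>1\<close> from the mode, where \<open>W x \<ge> x\<^sup>2 / 2\<close> forces the
  value \<open>1 / 2\<close>. This is why the search may assume that its upper end is a hit.
\<close>

lemma W_grid_last:
  assumes "\<bar>s\<bar> = 1"
  shows "1 / 2 \<le> W (s * (2 ^ max_index \<kappa> / sqrt \<kappa>))"
proof -
  let ?N = "max_index \<kappa>"
  have "log 2 \<kappa> / 2 \<le> real ?N" unfolding max_index_def by linarith
  then have "2 powr (log 2 \<kappa> / 2) \<le> 2 powr real ?N" by (intro powr_mono) auto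
  also have "2 powr (log 2 \<kappa> / 2) = (2 powr log 2 \<kappa>) powr (1 / 2)" by (simp add: powr_powr)
  also have "\<dots> = sqrt \<kappa>" using kappa_ge_1 by (simp add: powr_half_sqrt)
  finally have "sqrt \<kappa> \<le> 2 ^ ?N" by (simp add: powr_realpow)
  moreover have "0 < sqrt \<kappa>" using kappa_ge_1 by simp
  ultimately have "1 \<le> 2 ^ ?N / sqrt \<kappa>" by (simp add: field_simps)
  then have "1 \<le> \<bar>s * (2 ^ ?N / sqrt \<kappa>)\<bar>" using kappa_ge_1 by (simp add: assms abs_mult)
  then have "1 \<le> (s * (2 ^ ?N / sqrt \<kappa>))\<^sup>2" 
    using abs_le_square_iff[of 1 "s * (2 ^ ?N / sqrt \<kappa>)"] by simp
  then show ?thesis using W_ge[of "s * (2 ^ ?N / sqrt \<kappa>)"] by linarith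
qed

text \<open>
  The point found overshoots by at most a factor of two. If it is not the first grid point, then
  half of it is the previous grid point, which was rejected. If it is the first, it is at distance
  \<open>1 / sqrt \<kappa>\<close> from the mode, where smoothness keeps \<open>W\<close> at most \<open>1 / 2\<close>.
\<close>

lemma W_half_le:
  assumes "first_index \<kappa> W s i" "\<bar>s\<bar> = 1"
  shows "W (s * (2 ^ i / sqrt \<kappa>) / 2) \<le> 1 / 2"
proof (cases i)
  case 0
  have "W (s * (1 / sqrt \<kappa>) / 2) \<le> \<kappa> * (s * (1 / sqrt \<kappa>) / 2)\<^sup>2 / 2" by (rule W_le)
  also have "(s * (1 / sqrt \<kappa>) / 2)\<^sup>2 = 1 / (4 * \<kappa>)"
    using kappa_ge_1 power2_abs[of s] assms(2) by (simp add: power_mult_distrib power_divide)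
  finally show ?thesis using 0 kappa_ge_1 by simp
next
  case (Suc j)
  then have "W (s * (2 ^ j / sqrt \<kappa>)) < 1 / 2" using assms(1) by (simp add: first_index_def)
  moreover have "s * (2 ^ i / sqrt \<kappa>) / 2 = s * (2 ^ j / sqrt \<kappa>)" by (simp add: Suc)
  ultimately show ?thesis by simp
qed

text \<open>
  Convexity between \<open>0\<close> and \<open>y\<close> gives the slope bound \<open>W' y * y \<ge> W y \<ge> 1 / 2\<close>, and strong convexity
  extrapolates from \<open>y\<close> away from \<open>0\<close>. The hypothesis on the quotient says that \<open>x\<close> lies beyond \<open>y\<close>
  as seen from \<open>0\<close>, on whichever side \<open>y\<close> is.
\<close>

lemma tail_lower_bound:
  assumes "1 / 2 \<le> W y" "0 \<le> (x - y) / y" "y \<noteq> 0"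
  shows "(x - y) / (2 * y) + (x - y)\<^sup>2 / 2 \<le> W x"
proof -
  have "W y - W' y * y \<le> 0"
    using tangent_le[of y 0] by (simp add: W_0)
  then have "1 / 2 * ((x - y) / y) \<le> (W' y * y) * ((x - y) / y)"
    using assms by (intro mult_right_mono) auto
  then show ?thesis using strong_convexity[of y x] assms(1,3) by simp
qed

lemma envelope_ge:
  assumes "xm < 0" "0 < xp" "1 / 2 \<le> W xm" "1 / 2 \<le> W xp"
  shows "exp (- W x) \<le> envelope_fun xm xp x"
proof -
  consider "x \<le> xm" | "xm < x" "x \<le> xp" | "xp < x" by linarith
  then show ?thesis
  proof cases
    case 1
    then have "0 \<le> (x - xm) / xm" using assms(1) by (simp add: divide_nonpos_neg)
    with tail_lower_bound[OF assms(3) this] show ?thesis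
      using 1 assms(1) by (simp add: envelope_fun_def)
  next
    case 2
    then show ?thesis using W_nonneg[of x] by (simp add: envelope_fun_def)
  next
    case 3
    then have "0 \<le> (x - xp) / xp" using assms(2) by simp
    with tail_lower_bound[OF assms(4) this] show ?thesis
      using 3 assms(1,2) by (simp add: envelope_fun_def)
  qed
qed

text \<open>
  On \<open>{xm / 2..xp / 2}\<close> the potential is at most \<open>1 / 2\<close>, so the unnormalized target is
  at least \<open>exp (- 1 / 2) \<ge> 1 / 2\<close> there.
\<close>

lemma nn_integral_exp_W_ge:
  assumes "xm < 0" "0 < xp" "W (xm / 2) \<le> 1 / 2" "W (xp / 2) \<le> 1 / 2"
  shows "ennreal ((xp - xm) / 4) \<le> (\<integral>\<^sup>+x. ennreal (exp (- W x)) \<partial>lborel)"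
proof -
  have half: "1 / 2 \<le> exp (- W x)" if x: "xm / 2 \<le> x" "x \<le> xp / 2" for x
  proof -
    have "W x \<le> 1 / 2"
    proof (cases "0 \<le> x")
      case True
      then show ?thesis using W_scale_le[of "x / (xp / 2)" "xp / 2"] x assms by simp
    next
      case False
      then show ?thesis using W_scale_le[of "x / (xm / 2)" "xm / 2"] x assms
        by (simp add: divide_nonpos_neg divide_le_eq)
    qed
    then show ?thesis using exp_ge_add_one_self[of "- W x"] by linarith
  qed
  have "ennreal ((xp - xm) / 4) = ennreal (1 / 2) * ennreal (xp / 2 - xm / 2)"
    using assms by (subst ennreal_mult[symmetric]) (auto simp: diff_divide_distrib)
  also have "\<dots> = (\<integral>\<^sup>+x. ennreal (1 / 2) * indicator {xm / 2..xp / 2} x \<partial>lborel)"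
    using assms by (subst nn_integral_cmult_indicator) auto
  also have "\<dots> \<le> (\<integral>\<^sup>+x. ennreal (exp (- W x)) \<partial>lborel)"
  proof (intro nn_integral_mono)
    fix x
    show "ennreal (1 / 2) * indicator {xm / 2..xp / 2} x \<le> ennreal (exp (- W x))"
    proof (cases "x \<in> {xm / 2..xp / 2}")
      case True
      then show ?thesis using ennreal_leI[OF half, of x] by simp
    qed simp
  qed
  finally show ?thesis .
qed

end

section \<open>The mass of the envelope\<close>

lemma envelope_fun_pos: "0 < envelope_fun xm xp x"
  by (simp add: envelope_fun_def)

lemma envelope_fun_measurable [measurable]: "envelope_fun xm xp \<in> borel_measurable borel"
  unfolding envelope_fun_def[abs_def] by measurable

lemma nn_integral_exponential_tail:
  assumes "0 < l" "\<bar>c\<bar> = 1"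
  shows "(\<integral>\<^sup>+x. ennreal (exponential_density l (c * x + t)) \<partial>lborel) = 1"
proof -
  interpret prob_space "density lborel (exponential_density l)"
    by (rule prob_space_exponential_density[OF assms(1)])
  have "(\<integral>\<^sup>+x. ennreal (exponential_density l x) \<partial>lborel) = 1"
    using emeasure_space_1 by (simp add: emeasure_density)
  then show ?thesis
    using nn_integral_real_affine[of "\<lambda>x. ennreal (exponential_density l x)" c t] assms(2)
    by (cases "c = 0") (simp_all add: add.commute)
qed

text \<open>
  Dropping the quadratic terms leaves exponential tails of rates \<open>1 / (2 * xp)\<close> and
  \<open>1 / (2 * \<bar>xm\<bar>)\<close>, whose masses \<open>2 * xp\<close> and \<open>2 * \<bar>xm\<bar>\<close> are comparable to the length of the plateau.
\<close>

lemma nn_integral_envelope_le: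
  assumes "xm < 0" "0 < xp"
  shows "(\<integral>\<^sup>+x. ennreal (envelope_fun xm xp x) \<partial>lborel) \<le> ennreal (3 * (xp - xm))"
proof -
  let ?l = "\<lambda>x. ennreal (- (2 * xm)) * ennreal (exponential_density (1 / (- (2 * xm))) (- 1 * x + xm))"
  let ?r = "\<lambda>x. ennreal (2 * xp) * ennreal (exponential_density (1 / (2 * xp)) (1 * x + - xp))"
  have "ennreal (envelope_fun xm xp x) \<le> indicator {xm..xp} x + (?l x + ?r x)" for x
  proof -
    consider "x < xm" | "xm \<le> x" "x \<le> xp" | "xp < x" by linarith
    then show ?thesis
    proof cases
      case 1
      have "envelope_fun xm xp x = exp (- ((x - xm) / (2 * xm)) - (x - xm)\<^sup>2 / 2)"
        using 1 by (simp add: envelope_fun_def)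
      also have "\<dots> \<le> exp (- ((x - xm) / (2 * xm)))" by simp
      also have "- ((x - xm) / (2 * xm)) = - (xm - x) * (1 / (- (2 * xm)))"
        using assms by (simp add: field_simps)
      finally have "envelope_fun xm xp x
          \<le> - (2 * xm) * exponential_density (1 / (- (2 * xm))) (- 1 * x + xm)"
        using 1 assms by (simp add: exponential_density_def)
      then have "ennreal (envelope_fun xm xp x) \<le> ?l x"
        using assms by (subst ennreal_mult[symmetric]) (auto intro!: ennreal_leI exponential_density_nonneg)
      also have "\<dots> \<le> indicator {xm..xp} x + (?l x + ?r x)"
        by (metis add.commute add_increasing add_increasing2 order_refl zero_le)
      finally show ?thesis .
    next
      case 2
      then have "envelope_fun xm xp x = 1" by (auto simp: envelope_fun_def)
      then show ?thesis using 2 by (simp add: add_increasing2)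
    next
      case 3
      have "envelope_fun xm xp x = exp (- ((x - xp) / (2 * xp)) - (x - xp)\<^sup>2 / 2)"
        using 3 assms by (simp add: envelope_fun_def)
      also have "\<dots> \<le> exp (- ((x - xp) / (2 * xp)))" by simp
      also have "- ((x - xp) / (2 * xp)) = - (x - xp) * (1 / (2 * xp))"
        using assms by (simp add: field_simps)
      finally have "envelope_fun xm xp x
          \<le> (2 * xp) * exponential_density (1 / (2 * xp)) (1 * x + - xp)"
        using 3 assms by (simp add: exponential_density_def)
      then have "ennreal (envelope_fun xm xp x) \<le> ?r x"
        using assms by (subst ennreal_mult[symmetric]) (auto intro!: ennreal_leI exponential_density_nonneg)
      also have "\<dots> \<le> indicator {xm..xp} x + (?l x + ?r x)"
        by (metis add.commute add_increasing add_increasing2 order_refl zero_le)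
      finally show ?thesis .
    qed
  qed
  then have "(\<integral>\<^sup>+x. ennreal (envelope_fun xm xp x) \<partial>lborel)
      \<le> (\<integral>\<^sup>+x. indicator {xm..xp} x + (?l x + ?r x) \<partial>lborel)"
    by (intro nn_integral_mono)
  also have "\<dots> = ennreal (xp - xm) + (ennreal (- (2 * xm)) + ennreal (2 * xp))"
    using assms nn_integral_exponential_tail[of "1 / (- (2 * xm))" "- 1" xm]
      nn_integral_exponential_tail[of "1 / (2 * xp)" 1 "- xp"]
    by (simp add: nn_integral_add nn_integral_cmult del: mult_1_left mult_minus1)
  also have "\<dots> = ennreal (3 * (xp - xm))"
    using assms by (simp flip: ennreal_plus)
  finally show ?thesis .
qed

section \<open>Building the envelope for a rescaled target\<close>

lemma real_nat_ceiling_le: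
  assumes "x \<le> y" "0 \<le> y"
  shows "real (nat \<lceil>x\<rceil>) \<le> y + 1"
proof -
  have "real_of_int \<lceil>x\<rceil> \<le> y + 1" using assms(1) by linarith
  then show ?thesis using assms(2) by (cases "0 \<le> \<lceil>x\<rceil>") simp_all
qed

text \<open>
  The left-hand side counts one query at \<open>0\<close> and two binary searches over \<open>max_index \<kappa> + 1\<close>
  indices. There are \<open>O (1 + ln \<kappa>)\<close> indices, and a second logarithm comes from the search. The
  constant \<open>12\<close> is generous here; it is dictated by the acceptance probability.
\<close>

lemma ENVELOPE_query_bound:
  assumes "1 \<le> \<kappa>"
  shows "1 + 2 * real (nat \<lceil>log 2 (real (max_index \<kappa>) + 1)\<rceil>) \<le> 12 * (1 + ln (1 + ln \<kappa>))"
proof -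
  define L where "L = ln \<kappa>"
  have L: "0 \<le> L" using assms by (simp add: L_def)
  have "log 2 \<kappa> / 2 = L * (1 / (2 * ln 2))" by (simp add: log_def L_def)
  also have "\<dots> \<le> L * 1" using ln2_ge_two_thirds L by (intro mult_left_mono) (auto simp: divide_simps)
  finally have "log 2 \<kappa> / 2 \<le> L" by simp
  then have "real (max_index \<kappa>) + 1 \<le> 2 * (1 + L)"
    using real_nat_ceiling_le[of "log 2 \<kappa> / 2" L] L unfolding max_index_def by simp
  then have "log 2 (real (max_index \<kappa>) + 1) \<le> log 2 (2 * (1 + L))" using L by simp
  also have "\<dots> = 1 + ln (1 + L) * (1 / ln 2)" using L by (subst log_mult) (auto simp: log_def)
  also have "\<dots> \<le> 1 + ln (1 + L) * 2" using ln2_ge_two_thirds L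
    by (intro add_left_mono mult_left_mono) (auto simp: divide_simps)
  finally have "real (nat \<lceil>log 2 (real (max_index \<kappa>) + 1)\<rceil>) \<le> 1 + ln (1 + L) * 2 + 1"
    by (rule real_nat_ceiling_le) (use L in simp)
  moreover have "0 \<le> ln (1 + L)" using L by simp
  ultimately show ?thesis unfolding L_def[symmetric] distrib_left by linarith
qed

text \<open>
  A target of the class with its witnesses \<open>V'\<close> and \<open>V''\<close> for the derivatives, and the unknown
  offset \<open>c\<^sub>0\<close> of the oracle.
\<close>

locale sampling_target =
  fixes \<alpha> \<beta> c\<^sub>0 :: real and p :: "real measure" and V V' V'' :: "real \<Rightarrow> real"
  assumes alpha: "0 < \<alpha>"
    and p: "prob_space p" "p = density lborel (\<lambda>x. ennreal (exp (- V x)))"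
    and V: "\<And>x. (V has_real_derivative V' x) (at x)"
    and V': "\<And>x. (V' has_real_derivative V'' x) (at x)"
    and V'': "\<And>x. \<alpha> \<le> V'' x" "\<And>x. V'' x \<le> \<beta>"
    and V'_0: "V' 0 = 0"
begin

abbreviation "\<kappa> \<equiv> \<beta> / \<alpha>"
abbreviation "W \<equiv> rescaled_potential \<alpha> V"
abbreviation "oracle \<equiv> \<lambda>x. V x + c\<^sub>0"
abbreviation "v\<^sub>0 \<equiv> V 0 + c\<^sub>0"
abbreviation "grid \<equiv> \<lambda>i. 2 ^ i / sqrt \<kappa>"

sublocale potential W "\<lambda>x. V' (x / sqrt \<alpha>) / sqrt \<alpha>" "\<lambda>x. V'' (x / sqrt \<alpha>) / \<alpha>" \<kappa>
proof
  fix x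
  show "(W has_real_derivative V' (x / sqrt \<alpha>) / sqrt \<alpha>) (at x)"
  proof -
    have "((\<lambda>x. V (x / sqrt \<alpha>) - V 0) has_real_derivative V' (x / sqrt \<alpha>) * (1 / sqrt \<alpha>) - 0) (at x)"
      by (intro DERIV_diff DERIV_chain2[OF V] DERIV_cdivide DERIV_ident DERIV_const)
    then show ?thesis by (simp add: rescaled_potential_def[abs_def])
  qed
  have "((\<lambda>x. V' (x / sqrt \<alpha>) / sqrt \<alpha>) has_real_derivative
      V'' (x / sqrt \<alpha>) * (1 / sqrt \<alpha>) / sqrt \<alpha>) (at x)"
    by (intro DERIV_chain2[OF V'] DERIV_cdivide DERIV_ident)
  then show "((\<lambda>x. V' (x / sqrt \<alpha>) / sqrt \<alpha>) has_real_derivative V'' (x / sqrt \<alpha>) / \<alpha>) (at x)"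
    using alpha by simp
  show "1 \<le> V'' (x / sqrt \<alpha>) / \<alpha>" using alpha V''(1) by simp
  show "V'' (x / sqrt \<alpha>) / \<alpha> \<le> \<kappa>" using alpha V''(2) by (simp add: divide_right_mono)
qed (simp_all add: V'_0 rescaled_potential_def)

lemma V_measurable [measurable]: "V \<in> borel_measurable borel"
  by (rule borel_measurable_continuous_onI)
    (meson DERIV_isCont V continuous_at_imp_continuous_on)

lemma W_measurable [measurable]: "W \<in> borel_measurable borel"
  unfolding rescaled_potential_def[abs_def] by measurable

text \<open>
  Subtracting the answer at \<open>0\<close> removes the unknown offset, hence the algorithm effectively
  queries the rescaled potential.
\<close>

lemma oracle_eq: "oracle (x / sqrt \<alpha>) - v\<^sub>0 = W x"
  by (simp add: rescaled_potential_def)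

lemma grid_pos: "0 < grid i"
  using kappa_ge_1 by simp

lemma ENVELOPE_run:
  obtains im ip m where
    "first_index \<kappa> W (- 1) im" "first_index \<kappa> W 1 ip"
    "real m \<le> 12 * (1 + ln (1 + ln \<kappa>))"
    "run_within m oracle (ENVELOPE \<alpha> \<beta>) = Some (v\<^sub>0, envelope_fun (- grid im) (grid ip))"
proof -
  define N where "N = max_index \<kappa>"
  define d where "d = nat \<lceil>log 2 (real N + 1)\<rceil>"
  have "real N + 1 = 2 powr log 2 (real N + 1)" by simp
  also have "\<dots> \<le> 2 powr real d" by (intro powr_mono) (auto simp: d_def)
  finally have "real N + 1 \<le> 2 ^ d" by (simp add: powr_realpow)
  \<comment> \<open>The search is over the \<open>N + 1\<close> indices \<open>0, \<dots>, N\<close>.\<close>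
  then have N: "N - 0 < 2 ^ d" by (metis Suc_eq_plus1 Suc_le_lessD diff_zero of_nat_1 of_nat_add
      of_nat_le_iff of_nat_numeral of_nat_power)
  let ?P = "\<lambda>v. v - v\<^sub>0 \<ge> 1 / 2"
  let ?pt = "\<lambda>i. grid i / sqrt \<alpha>" and ?pt' = "\<lambda>i. - grid i / sqrt \<alpha>"
  have P: "?P (oracle (?pt i)) \<longleftrightarrow> 1 / 2 \<le> W (1 * grid i)"
    "?P (oracle (?pt' i)) \<longleftrightarrow> 1 / 2 \<le> W (- 1 * grid i)" for i
    unfolding oracle_eq by simp_all
  define k' where "k' ip im = Return (v\<^sub>0, envelope_fun (- grid im) (grid ip))" for ip im
  define k where "k ip = binary_search ?pt' ?P 0 N (k' ip)" for ip
  have "\<exists>i m. 0 \<le> i \<and> i \<le> N \<and> ?P (oracle (?pt i)) \<and>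
      (\<forall>j. 0 \<le> j \<longrightarrow> j < i \<longrightarrow> \<not> ?P (oracle (?pt j))) \<and> m \<le> d \<and>
      (\<forall>r. run_within (m + r) oracle (binary_search ?pt ?P 0 N k) = run_within r oracle (k i))"
    by (rule binary_search_finds_first[OF _ N])
      (use W_grid_last[of 1] W_grid_mono[of _ _ 1] in \<open>auto simp only: P N_def abs_one intro: order_trans\<close>)
  then obtain ip mp where ip: "ip \<le> N" "1 / 2 \<le> W (1 * grid ip)" "\<forall>j<ip. W (1 * grid j) < 1 / 2"
      "mp \<le> d" "\<And>r. run_within (mp + r) oracle (binary_search ?pt ?P 0 N k) = run_within r oracle (k ip)"
    unfolding P by (auto simp: not_le)
  have "\<exists>i m. 0 \<le> i \<and> i \<le> N \<and> ?P (oracle (?pt' i)) \<and>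
      (\<forall>j. 0 \<le> j \<longrightarrow> j < i \<longrightarrow> \<not> ?P (oracle (?pt' j))) \<and> m \<le> d \<and>
      (\<forall>r. run_within (m + r) oracle (binary_search ?pt' ?P 0 N (k' ip)) = run_within r oracle (k' ip i))"
    by (rule binary_search_finds_first[OF _ N])
      (use W_grid_last[of "- 1"] W_grid_mono[of _ _ "- 1"] in \<open>auto simp only: P N_def abs_minus_cancel abs_one intro: order_trans\<close>)
  then obtain im mm where im: "im \<le> N" "1 / 2 \<le> W (- 1 * grid im)" "\<forall>j<im. W (- 1 * grid j) < 1 / 2"
      "mm \<le> d" "\<And>r. run_within (mm + r) oracle (k ip) = run_within r oracle (k' ip im)"
    unfolding P k_def by (auto simp: not_le)
  have "ENVELOPE \<alpha> \<beta> = Query 0 (\<lambda>v\<^sub>0. binary_search ?pt (\<lambda>v. v - v\<^sub>0 \<ge> 1 / 2) 0 N (\<lambda>ip.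
      binary_search ?pt' (\<lambda>v. v - v\<^sub>0 \<ge> 1 / 2) 0 N (\<lambda>im.
      Return (v\<^sub>0, envelope_fun (- grid im) (grid ip)))))"
    by (simp add: ENVELOPE_def Let_def N_def)
  then have "run_within (Suc (mp + (mm + 0))) oracle (ENVELOPE \<alpha> \<beta>)
      = run_within (mp + (mm + 0)) oracle (binary_search ?pt ?P 0 N k)"
    by (simp add: k_def[abs_def] k'_def[abs_def])
  also have "\<dots> = Some (v\<^sub>0, envelope_fun (- grid im) (grid ip))"
    unfolding ip(5) im(5) by (simp add: k'_def)
  finally have "run_within (Suc (mp + mm)) oracle (ENVELOPE \<alpha> \<beta>)
      = Some (v\<^sub>0, envelope_fun (- grid im) (grid ip))" by simp
  moreover have "real (Suc (mp + mm)) \<le> 12 * (1 + ln (1 + ln \<kappa>))"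
    using ENVELOPE_query_bound[OF kappa_ge_1] ip(4) im(4) unfolding d_def N_def by linarith
  moreover have "first_index \<kappa> W (- 1) im" "first_index \<kappa> W 1 ip"
    using ip(1-3) im(1-3) unfolding first_index_def N_def by auto
  ultimately show ?thesis using that by blast
qed

text \<open>
  Change of variables \<open>x = sqrt \<alpha> * y\<close>. It shows that scaling an accepted point back yields the
  original target up to the normalizing constant \<open>sqrt \<alpha> * exp (V 0)\<close>.
\<close>

lemma nn_integral_exp_W:
  assumes [measurable]: "A \<in> sets borel"
  shows "(\<integral>\<^sup>+x. ennreal (exp (- W x)) * indicator A (x / sqrt \<alpha>) \<partial>lborel)
    = ennreal (sqrt \<alpha> * exp (V 0)) * emeasure p A"
proof -
  have "(\<integral>\<^sup>+x. ennreal (exp (- W x)) * indicator A (x / sqrt \<alpha>) \<partial>lborel)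
    = ennreal (sqrt \<alpha>) * (\<integral>\<^sup>+y. ennreal (exp (- W (0 + sqrt \<alpha> * y))) * indicator A ((0 + sqrt \<alpha> * y) / sqrt \<alpha>) \<partial>lborel)"
    using alpha by (subst nn_integral_real_affine[where c = "sqrt \<alpha>" and t = 0]) auto
  also have "(\<integral>\<^sup>+y. ennreal (exp (- W (0 + sqrt \<alpha> * y))) * indicator A ((0 + sqrt \<alpha> * y) / sqrt \<alpha>) \<partial>lborel)
    = (\<integral>\<^sup>+y. ennreal (exp (V 0)) * (ennreal (exp (- V y)) * indicator A y) \<partial>lborel)"
  proof (rule nn_integral_cong)
    fix y
    have "exp (- W (sqrt \<alpha> * y)) = exp (V 0) * exp (- V y)"
      using alpha by (simp add: rescaled_potential_def flip: exp_add)
    then show "ennreal (exp (- W (0 + sqrt \<alpha> * y))) * indicator A ((0 + sqrt \<alpha> * y) / sqrt \<alpha>)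
      = ennreal (exp (V 0)) * (ennreal (exp (- V y)) * indicator A y)"
      using alpha by (simp add: ennreal_mult mult.assoc)
  qed
  also have "\<dots> = ennreal (exp (V 0)) * emeasure p A"
    by (subst nn_integral_cmult) (auto simp: p(2) emeasure_density)
  finally show ?thesis by (simp add: ennreal_mult alpha less_imp_le mult.assoc)
qed

lemma nn_integral_exp_W_UNIV:
  "(\<integral>\<^sup>+x. ennreal (exp (- W x)) \<partial>lborel) = ennreal (sqrt \<alpha> * exp (V 0))"
  using nn_integral_exp_W[of UNIV] prob_space.emeasure_space_1[OF p(1)]
    sets_eq_imp_space_eq[of p borel] p(2) by simp

end

section \<open>Sampling with the envelope\<close>

text \<open>
  The acceptance ratio \<open>g / q\<close> cancels the proposal density \<open>q / Q\<close>, so that an accepted point has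
  the unnormalized density \<open>g / Q\<close>. The hypothesis \<open>g \<le> q\<close> makes the ratio a probability.
\<close>

lemma emeasure_accepted:
  assumes [measurable]: "g \<in> borel_measurable borel" "q \<in> borel_measurable borel"
      "h \<in> borel_measurable borel" "A \<in> sets borel"
    and gq: "\<And>x. 0 < g x" "\<And>x. g x \<le> q x" and Q: "0 < Q"
  shows "emeasure (density lborel (\<lambda>x. ennreal (q x / Q)) \<Otimes>\<^sub>M uniform_measure lborel {0..1})
      {z. snd z \<le> g (fst z) / q (fst z) \<and> h (fst z) \<in> A}
    = (\<integral>\<^sup>+x. ennreal (1 / Q) * (ennreal (g x) * indicator A (h x)) \<partial>lborel)"
proof -
  let ?U = "uniform_measure lborel {0..1::real}" and ?S = "{z. snd z \<le> g (fst z) / q (fst z) \<and> h (fst z) \<in> A}"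
  interpret U: prob_space ?U by (rule prob_space_uniform_measure) auto
  have [measurable]: "?S \<in> sets (density lborel (\<lambda>x. ennreal (q x / Q)) \<Otimes>\<^sub>M ?U)"
  proof -
    have "{z \<in> space (borel \<Otimes>\<^sub>M borel). snd z \<le> g (fst z) / q (fst z) \<and> h (fst z) \<in> A} \<in> sets (borel \<Otimes>\<^sub>M borel)"
      by measurable
    moreover have "sets (density lborel (\<lambda>x. ennreal (q x / Q)) \<Otimes>\<^sub>M ?U) = sets (borel \<Otimes>\<^sub>M borel)"
      by (intro sets_pair_measure_cong) auto
    ultimately show ?thesis by (simp add: space_pair_measure)
  qed
  have q: "0 < q x" for x using gq less_le_trans by blast
  have slice: "emeasure ?U (Pair x -` ?S) = ennreal (g x / q x) * indicator A (h x)" for x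
  proof (cases "h x \<in> A")
    case True
    have "0 \<le> g x / q x" "g x / q x \<le> 1" using gq[of x] q[of x] by auto
    moreover from this have "{0..1} \<inter> {..g x / q x} = {0..g x / q x}" by auto
    moreover have "Pair x -` ?S = {..g x / q x}" using True by auto
    ultimately show ?thesis using True by (simp add: emeasure_uniform_measure divide_ennreal_def)
  qed (simp add: vimage_def)
  have "emeasure (density lborel (\<lambda>x. ennreal (q x / Q)) \<Otimes>\<^sub>M ?U) ?S
      = (\<integral>\<^sup>+x. emeasure ?U (Pair x -` ?S) \<partial>density lborel (\<lambda>x. ennreal (q x / Q)))"
    by (rule U.emeasure_pair_measure_alt) measurable
  also have "\<dots> = (\<integral>\<^sup>+x. ennreal (q x / Q) * (ennreal (g x / q x) * indicator A (h x)) \<partial>lborel)"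
    unfolding slice by (rule nn_integral_density) measurable
  also have "\<dots> = (\<integral>\<^sup>+x. ennreal (1 / Q) * (ennreal (g x) * indicator A (h x)) \<partial>lborel)"
  proof (rule nn_integral_cong)
    fix x
    have "q x / Q * (g x / q x) = 1 / Q * g x" using q[of x] by simp
    then have "ennreal (q x / Q) * ennreal (g x / q x) = ennreal (1 / Q) * ennreal (g x)"
      using q[of x] gq(1)[of x] Q by (simp add: ennreal_mult[symmetric])
    then show "ennreal (q x / Q) * (ennreal (g x / q x) * indicator A (h x))
      = ennreal (1 / Q) * (ennreal (g x) * indicator A (h x))" by (simp add: mult.assoc[symmetric])
  qed
  finally show ?thesis .
qed

locale envelope_target = sampling_target +
  fixes im ip :: nat
  assumes first: "first_index \<kappa> W (- 1) im" "first_index \<kappa> W 1 ip"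
begin

abbreviation "q \<equiv> envelope_fun (- grid im) (grid ip)"
abbreviation "Q \<equiv> \<integral>y. q y \<partial>lborel"
text \<open>
  The mass of \<open>exp (- W)\<close> divided by that of \<open>q\<close>, which is the probability of accepting a proposal.
\<close>

abbreviation "a \<equiv> sqrt \<alpha> * exp (V 0) / Q"

lemma q_ge: "exp (- W x) \<le> q x"
  by (rule envelope_ge) (use first kappa_ge_1 in \<open>auto simp: first_index_def\<close>)

lemma Z_ge: "(grid ip + grid im) / 4 \<le> sqrt \<alpha> * exp (V 0)"
proof -
  have "ennreal ((grid ip - - grid im) / 4) \<le> (\<integral>\<^sup>+x. ennreal (exp (- W x)) \<partial>lborel)"
    by (rule nn_integral_exp_W_ge)
      (use first[THEN W_half_le] grid_pos[of im] grid_pos[of ip] in auto)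
  also have "\<dots> = ennreal (sqrt \<alpha> * exp (V 0))"
    by (rule nn_integral_exp_W_UNIV)
  finally show ?thesis using alpha by (subst (asm) ennreal_le_iff) auto
qed

lemma nn_integral_q_le: "(\<integral>\<^sup>+x. ennreal (q x) \<partial>lborel) \<le> ennreal (3 * (grid ip + grid im))"
  using nn_integral_envelope_le[of "- grid im" "grid ip"] grid_pos[of im] grid_pos[of ip] by simp

lemma integrable_q: "integrable lborel q"
  by (rule integrableI_nonneg)
    (use nn_integral_q_le in \<open>auto simp: less_imp_le envelope_fun_pos intro: le_less_trans\<close>)

lemma nn_integral_q: "(\<integral>\<^sup>+x. ennreal (q x) \<partial>lborel) = ennreal Q"
  by (rule nn_integral_eq_integral[OF integrable_q]) (simp add: less_imp_le envelope_fun_pos)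

lemma Q_le: "Q \<le> 3 * (grid ip + grid im)"
  using nn_integral_q_le grid_pos[of im] grid_pos[of ip] unfolding nn_integral_q
  by (subst (asm) ennreal_le_iff) auto

lemma Q_pos: "0 < Q"
proof -
  have "(\<integral>\<^sup>+x. ennreal (exp (- W x)) \<partial>lborel) \<le> (\<integral>\<^sup>+x. ennreal (q x) \<partial>lborel)"
    by (intro nn_integral_mono ennreal_leI q_ge)
  then have "ennreal (sqrt \<alpha> * exp (V 0)) \<le> ennreal Q"
    unfolding nn_integral_exp_W_UNIV nn_integral_q .
  moreover have "0 < sqrt \<alpha> * exp (V 0)" using alpha by simp
  ultimately show ?thesis by (simp add: ennreal_le_iff2)
qed

text \<open>
  The plateau cancels: the target has mass at least a quarter of its length and the envelope at
  most three times its length.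
\<close>

lemma a_ge: "1 / 12 \<le> a"
  using Z_ge Q_le Q_pos by (simp add: field_simps)

lemma prob_space_proposal: "prob_space (proposal q)"
proof
  have "emeasure (proposal q) (space (proposal q)) = (\<integral>\<^sup>+x. ennreal (1 / Q) * ennreal (q x) \<partial>lborel)"
    using Q_pos less_imp_le[OF envelope_fun_pos]
    by (auto simp: proposal_def emeasure_density ennreal_mult[symmetric] intro!: nn_integral_cong)
  also have "\<dots> = 1"
    using Q_pos by (subst nn_integral_cmult) (auto simp: nn_integral_q ennreal_mult[symmetric])
  finally show "emeasure (proposal q) (space (proposal q)) = 1" .
qed

sublocale M: prob_space "proposal q \<Otimes>\<^sub>M uniform_measure lborel {0..1::real}"
proof -
  interpret P: prob_space "proposal q" by (rule prob_space_proposal)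
  interpret U: prob_space "uniform_measure lborel {0..1::real}" by (rule prob_space_uniform_measure) auto
  interpret pair: pair_prob_space "proposal q" "uniform_measure lborel {0..1::real}" ..
  show "prob_space (proposal q \<Otimes>\<^sub>M uniform_measure lborel {0..1::real})" by unfold_locales
qed

lemma sets_M: "sets (proposal q \<Otimes>\<^sub>M uniform_measure lborel {0..1::real}) = sets (borel \<Otimes>\<^sub>M borel)"
  unfolding proposal_def by (intro sets_pair_measure_cong) auto

sublocale rejection_sampling "proposal q \<Otimes>\<^sub>M uniform_measure lborel {0..1::real}"
  "\<lambda>z. snd z \<le> exp (- W (fst z)) / q (fst z)" "\<lambda>z. fst z / sqrt \<alpha>" a p "oracle"
  "SAMPLE \<alpha> v\<^sub>0 q"
proof (intro rejection_sampling.intro rejection_sampling_axioms.intro M.prob_space_axioms)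
  show "sets p = sets borel" by (simp add: p(2))
  show "Measurable.pred (proposal q \<Otimes>\<^sub>M uniform_measure lborel {0..1::real}) (\<lambda>z. snd z \<le> exp (- W (fst z)) / q (fst z))"
    unfolding measurable_cong_sets[OF sets_M refl] by measurable
  show "(\<lambda>z. fst z / sqrt \<alpha>) \<in> borel_measurable (proposal q \<Otimes>\<^sub>M uniform_measure lborel {0..1::real})"
    unfolding measurable_cong_sets[OF sets_M refl] by measurable
  show "0 < a" using a_ge by linarith
  show "run_within 0 oracle (SAMPLE \<alpha> v\<^sub>0 q \<omega>) = None" for \<omega>
    by (subst SAMPLE.code) simp
  show "run_within (Suc n) oracle (SAMPLE \<alpha> v\<^sub>0 q \<omega>) =
      (if snd (shd \<omega>) \<le> exp (- W (fst (shd \<omega>))) / q (fst (shd \<omega>)) then Some (fst (shd \<omega>) / sqrt \<alpha>)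
       else run_within n oracle (SAMPLE \<alpha> v\<^sub>0 q (stl \<omega>)))" for n \<omega>
    by (subst SAMPLE.code) (simp add: rescaled_potential_def run_within_Return)
  fix A :: "real set" assume A [measurable]: "A \<in> sets borel"
  have "emeasure (proposal q \<Otimes>\<^sub>M uniform_measure lborel {0..1::real})
      {z. snd z \<le> exp (- W (fst z)) / q (fst z) \<and> fst z / sqrt \<alpha> \<in> A}
    = (\<integral>\<^sup>+x. ennreal (1 / Q) * (ennreal (exp (- W x)) * indicator A (x / sqrt \<alpha>)) \<partial>lborel)"
    unfolding proposal_def by (rule emeasure_accepted) (use q_ge Q_pos in auto)
  also have "\<dots> = ennreal (1 / Q) * (ennreal (sqrt \<alpha> * exp (V 0)) * emeasure p A)"
    by (subst nn_integral_cmult) (auto simp: nn_integral_exp_W)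
  also have "\<dots> = ennreal (a * measure p A)"
    using Q_pos alpha finite_measure.emeasure_eq_measure[OF prob_space.finite_measure[OF p(1)]]
    by (simp add: ennreal_mult[symmetric])
  finally have eq: "emeasure (proposal q \<Otimes>\<^sub>M uniform_measure lborel {0..1::real})
      {z. snd z \<le> exp (- W (fst z)) / q (fst z) \<and> fst z / sqrt \<alpha> \<in> A} = ennreal (a * measure p A)" .
  have "space (proposal q \<Otimes>\<^sub>M uniform_measure lborel {0..1::real}) = UNIV"
    by (simp add: space_pair_measure proposal_def)
  then show "M.prob {z \<in> space (proposal q \<Otimes>\<^sub>M uniform_measure lborel {0..1::real}).
      snd z \<le> exp (- W (fst z)) / q (fst z) \<and> fst z / sqrt \<alpha> \<in> A} = a * measure p A"
    using eq alpha Q_pos by (simp add: measure_def)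
qed (rule p(1))

lemma failure_prob_le:
  assumes "0 < \<epsilon>" "12 * ln (1 / \<epsilon>) \<le> real n"
  shows "(1 - a) ^ n \<le> \<epsilon>"
proof -
  have "(1 - a) ^ n \<le> exp (- (1 / 12)) ^ n"
    using a_ge a_le_1 exp_ge_add_one_self[of "- (1 / 12)"] by (intro power_mono) linarith+
  also have "\<dots> = exp (- (real n / 12))" by (simp add: exp_of_nat_mult[symmetric])
  also have "\<dots> \<le> exp (ln \<epsilon>)" unfolding exp_le_cancel_iff using assms by (simp add: ln_div)
  also have "\<dots> = \<epsilon>" using assms by simp
  finally show ?thesis .
qed

end

theorem theorem3:
  shows "\<exists>C::real. C > 0 \<and>
    (\<forall>(\<alpha>::real) (\<beta>::real) (p::real measure) (V::real \<Rightarrow> real) (c\<^sub>0::real).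
      0 < \<alpha> \<longrightarrow> \<alpha> \<le> \<beta> \<longrightarrow> target_class \<alpha> \<beta> p V \<longrightarrow>
      (let \<kappa> = \<beta> / \<alpha>;
           oracle = (\<lambda>x. V x + c\<^sub>0);
           W = rescaled_potential \<alpha> V
       in ennreal_of_enat (num_queries oracle (ENVELOPE \<alpha> \<beta>)) \<le> ennreal (C * (1 + ln (1 + ln \<kappa>))) \<and>
          (\<exists>v\<^sub>0 q. run oracle (ENVELOPE \<alpha> \<beta>) = Some (v\<^sub>0, q) \<and>
            (\<exists>i\<^sub>m i\<^sub>p. first_index \<kappa> W (-1) i\<^sub>m \<and> first_index \<kappa> W 1 i\<^sub>p \<and>
                     q = envelope_fun (- (2 ^ i\<^sub>m / sqrt \<kappa>)) (2 ^ i\<^sub>p / sqrt \<kappa>)) \<and>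
            (\<forall>x. q x \<ge> exp (- W x)) \<and>
            prob_space (draws q) \<and>
            \<comment> \<open>exact sampling\<close>
            ((\<lambda>\<omega>. run oracle (SAMPLE \<alpha> v\<^sub>0 q \<omega>)) \<in> draws q \<rightarrow>\<^sub>M borel_failure \<and>
             distr (draws q) borel_failure (\<lambda>\<omega>. run oracle (SAMPLE \<alpha> v\<^sub>0 q \<omega>)) = with_failure p \<and>
             (\<lambda>\<omega>. ennreal_of_enat (num_queries oracle (SAMPLE \<alpha> v\<^sub>0 q \<omega>))) \<in> borel_measurable (draws q) \<and>
             (\<integral>\<^sup>+\<omega>. ennreal_of_enat (num_queries oracle (SAMPLE \<alpha> v\<^sub>0 q \<omega>)) \<partial>draws q) \<le> ennreal C) \<and>
            \<comment> \<open>approximate sampling\<close>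
            (\<forall>\<epsilon>::real. 0 < \<epsilon> \<longrightarrow> \<epsilon> < 1 \<longrightarrow>
              (let n = nat \<lceil>C * ln (1 / \<epsilon>)\<rceil>;
                   output = (\<lambda>\<omega>. run_within n oracle (SAMPLE \<alpha> v\<^sub>0 q \<omega>))
               in output \<in> draws q \<rightarrow>\<^sub>M borel_failure \<and>
                  tv_dist (distr (draws q) borel_failure output) (with_failure p) \<le> \<epsilon>)))))"
proof (intro exI[of _ 12] conjI allI impI)
  fix \<alpha> \<beta> c\<^sub>0 :: real and p :: "real measure" and V :: "real \<Rightarrow> real"
  assume "0 < \<alpha>" "target_class \<alpha> \<beta> p V"
  then obtain V' V'' where "sampling_target \<alpha> \<beta> p V V' V''"
    unfolding target_class_def sampling_target_def by blast
  then interpret sampling_target \<alpha> \<beta> c\<^sub>0 p V V' V'' .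
  obtain im ip m where first: "first_index \<kappa> W (- 1) im" "first_index \<kappa> W 1 ip"
    and m: "real m \<le> 12 * (1 + ln (1 + ln \<kappa>))"
      "run_within m oracle (ENVELOPE \<alpha> \<beta>) = Some (v\<^sub>0, envelope_fun (- grid im) (grid ip))"
    by (rule ENVELOPE_run)
  interpret envelope_target \<alpha> \<beta> c\<^sub>0 p V V' V'' im ip
    by unfold_locales (rule first)+
  have "num_queries oracle (ENVELOPE \<alpha> \<beta>) \<le> enat m" by (rule num_queries_le) (simp add: m)
  then have "ennreal_of_enat (num_queries oracle (ENVELOPE \<alpha> \<beta>)) \<le> ennreal_of_enat (enat m)"
    by (simp only: ennreal_of_enat_le_iff)
  also have "\<dots> \<le> ennreal (12 * (1 + ln (1 + ln \<kappa>)))"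
    using m(1) by (simp add: ennreal_leI flip: ennreal_of_nat_eq_real_of_nat)
  finally have queries: "ennreal_of_enat (num_queries oracle (ENVELOPE \<alpha> \<beta>)) \<le> ennreal (12 * (1 + ln (1 + ln \<kappa>)))" .
  have "1 / a \<le> 1 / (1 / 12)" by (rule divide_left_mono[OF a_ge _ mult_pos_pos[OF a_pos]]) simp_all
  also have "\<dots> = 12" by simp
  finally have "1 / a \<le> 12" .
  then have expected: "(\<integral>\<^sup>+\<omega>. ennreal_of_enat (num_queries oracle (SAMPLE \<alpha> v\<^sub>0 q \<omega>)) \<partial>draws q) \<le> ennreal 12"
    unfolding draws_def expected_num_queries by (rule ennreal_leI)
  have approx: "tv_dist (distr (draws q) borel_failure
      (\<lambda>\<omega>. run_within (nat \<lceil>12 * ln (1 / \<epsilon>)\<rceil>) oracle (SAMPLE \<alpha> v\<^sub>0 q \<omega>))) (with_failure p) \<le> \<epsilon>"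
    if "0 < \<epsilon>" for \<epsilon>
    unfolding draws_def by (rule order_trans[OF tv_dist_run_within failure_prob_le[OF that]]) linarith
  note sample = measurable_run measurable_run_within distr_run measurable_num_queries
    M.prob_space_stream_space
  show "let \<kappa> = \<beta> / \<alpha>; oracle = (\<lambda>x. V x + c\<^sub>0); W = rescaled_potential \<alpha> V
       in ennreal_of_enat (num_queries oracle (ENVELOPE \<alpha> \<beta>)) \<le> ennreal (12 * (1 + ln (1 + ln \<kappa>))) \<and>
          (\<exists>v\<^sub>0 q. run oracle (ENVELOPE \<alpha> \<beta>) = Some (v\<^sub>0, q) \<and>
            (\<exists>i\<^sub>m i\<^sub>p. first_index \<kappa> W (-1) i\<^sub>m \<and> first_index \<kappa> W 1 i\<^sub>p \<and>
                     q = envelope_fun (- (2 ^ i\<^sub>m / sqrt \<kappa>)) (2 ^ i\<^sub>p / sqrt \<kappa>)) \<and>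
            (\<forall>x. q x \<ge> exp (- W x)) \<and>
            prob_space (draws q) \<and>
            ((\<lambda>\<omega>. run oracle (SAMPLE \<alpha> v\<^sub>0 q \<omega>)) \<in> draws q \<rightarrow>\<^sub>M borel_failure \<and>
             distr (draws q) borel_failure (\<lambda>\<omega>. run oracle (SAMPLE \<alpha> v\<^sub>0 q \<omega>)) = with_failure p \<and>
             (\<lambda>\<omega>. ennreal_of_enat (num_queries oracle (SAMPLE \<alpha> v\<^sub>0 q \<omega>))) \<in> borel_measurable (draws q) \<and>
             (\<integral>\<^sup>+\<omega>. ennreal_of_enat (num_queries oracle (SAMPLE \<alpha> v\<^sub>0 q \<omega>)) \<partial>draws q) \<le> ennreal 12) \<and>
            (\<forall>\<epsilon>::real. 0 < \<epsilon> \<longrightarrow> \<epsilon> < 1 \<longrightarrow>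
              (let n = nat \<lceil>12 * ln (1 / \<epsilon>)\<rceil>;
                   output = (\<lambda>\<omega>. run_within n oracle (SAMPLE \<alpha> v\<^sub>0 q \<omega>))
               in output \<in> draws q \<rightarrow>\<^sub>M borel_failure \<and>
                  tv_dist (distr (draws q) borel_failure output) (with_failure p) \<le> \<epsilon>)))"
    unfolding Let_def
  proof (intro conjI exI[of _ v\<^sub>0] exI[of _ q] allI impI)
    show "run oracle (ENVELOPE \<alpha> \<beta>) = Some (v\<^sub>0, q)" by (rule run_eq_run_within[OF m(2)])
    show "\<exists>i\<^sub>m i\<^sub>p. first_index \<kappa> W (-1) i\<^sub>m \<and> first_index \<kappa> W 1 i\<^sub>p \<and>
        q = envelope_fun (- grid i\<^sub>m) (grid i\<^sub>p)"
      using first by blast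
  qed (use queries expected approx q_ge in
      \<open>simp_all add: sample[folded draws_def] flip: draws_def\<close>)
qed simp

end
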